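(* There is a polynomial time algorithm which, given $A=(a_{i,j})\in\mathcal{S}^n$, decides whether there is an $n\times n$ permutation matrix $P$ such that $P^\top A P\in\mathcal{M}_n$.
   Context: $\mathcal{S}^n$ is the set of real symmetric $n\times n$ matrices. $\mathcal{M}_n=\{A=(a_{i,j})\in\mathcal{S}^n : a_{i,j}\le a_{k,\ell} \text{ whenever } i\le k,\ j\le \ell,\ i\neq j,\ k\neq \ell\}$. *)

theory Defs
  imports
    "Jordan_Normal_Form.Matrix"
    "HOL-Library.Log_Nat"
    "HOL-Computational_Algebra.Polynomial"
    "HOL-Combinatorics.Permutations"
begin

section \<open>Matrices\<close>

definition sym_mats :: "nat \<Rightarrow> real mat set" where
  "sym_mats n = {A \<in> carrier_mat n n. transpose_mat A = A}"

text \<open>Indices are 0-based. The diagonal of the matrix is unconstrained.\<close>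

definition monotone_mats :: "nat \<Rightarrow> real mat set" where
  "monotone_mats n = {A \<in> sym_mats n.
     \<forall>i<n. \<forall>j<n. \<forall>k<n. \<forall>l<n.
       i \<le> k \<and> j \<le> l \<and> i \<noteq> j \<and> k \<noteq> l \<longrightarrow> A $$ (i, j) \<le> A $$ (k, l)}"

definition permutation_mats :: "nat \<Rightarrow> real mat set" where
  "permutation_mats n =
     {mat n n (\<lambda>(i, j). if i = \<pi> j then 1 else 0) | \<pi>. \<pi> permutes {..<n}}"

section \<open>A random access machine over the reals\<close>

text \<open>
  The machine has two sorts of data, natural numbers (counters and addresses) and real numbers.
  Each sort has registers, whose names are fixed in the program text, and a memory that can only
  be accessed by load and store instructions through an address held in a natural-number register.

  The instruction set is chosen so that charging one unit per instruction is an honest measure: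
  natural numbers can only be added and subtracted (with multiplication or division, repeated
  squaring would give exponentially many bits in linearly many steps), there is no conversion from
  real to natural numbers (such as the floor function), and the only constants in a program are
  integers (an arbitrary real constant could encode infinitely many bits of advice).
\<close>

record state =
  nreg :: "nat \<Rightarrow> nat"
  nmem :: "nat \<Rightarrow> nat"
  rreg :: "nat \<Rightarrow> real"
  rmem :: "nat \<Rightarrow> real"

datatype instr =
    NConst nat nat | NCopy nat nat | NAdd nat nat nat | NSub nat nat nat
  | NLoad nat nat | NStore nat nat
  | RConst nat int | RCopy nat nat | RAdd nat nat nat | RSub nat nat nat
  | RMul nat nat nat | RDiv nat nat nat
  | RLoad nat nat | RStore nat nat

text \<open>The target comes first, except that the first argument of a store instruction is the
  natural-number register holding the target address. Subtraction of natural numbers is truncated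
  at 0, and division by 0 gives 0.\<close>

fun effect :: "instr \<Rightarrow> state \<Rightarrow> state" where
  "effect (NConst x k) s = s\<lparr>nreg := (nreg s)(x := k)\<rparr>"
| "effect (NCopy x y) s = s\<lparr>nreg := (nreg s)(x := nreg s y)\<rparr>"
| "effect (NAdd x y z) s = s\<lparr>nreg := (nreg s)(x := nreg s y + nreg s z)\<rparr>"
| "effect (NSub x y z) s = s\<lparr>nreg := (nreg s)(x := nreg s y - nreg s z)\<rparr>"
| "effect (NLoad x y) s = s\<lparr>nreg := (nreg s)(x := nmem s (nreg s y))\<rparr>"
| "effect (NStore x y) s = s\<lparr>nmem := (nmem s)(nreg s x := nreg s y)\<rparr>"
| "effect (RConst x k) s = s\<lparr>rreg := (rreg s)(x := real_of_int k)\<rparr>"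
| "effect (RCopy x y) s = s\<lparr>rreg := (rreg s)(x := rreg s y)\<rparr>"
| "effect (RAdd x y z) s = s\<lparr>rreg := (rreg s)(x := rreg s y + rreg s z)\<rparr>"
| "effect (RSub x y z) s = s\<lparr>rreg := (rreg s)(x := rreg s y - rreg s z)\<rparr>"
| "effect (RMul x y z) s = s\<lparr>rreg := (rreg s)(x := rreg s y * rreg s z)\<rparr>"
| "effect (RDiv x y z) s = s\<lparr>rreg := (rreg s)(x := rreg s y / rreg s z)\<rparr>"
| "effect (RLoad x y) s = s\<lparr>rreg := (rreg s)(x := rmem s (nreg s y))\<rparr>"
| "effect (RStore x y) s = s\<lparr>rmem := (rmem s)(nreg s x := rreg s y)\<rparr>"

datatype test = NLess nat nat | NEq nat nat | RLess nat nat | REq nat nat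

fun holds :: "test \<Rightarrow> state \<Rightarrow> bool" where
  "holds (NLess x y) s \<longleftrightarrow> nreg s x < nreg s y"
| "holds (NEq x y) s \<longleftrightarrow> nreg s x = nreg s y"
| "holds (RLess x y) s \<longleftrightarrow> rreg s x < rreg s y"
| "holds (REq x y) s \<longleftrightarrow> rreg s x = rreg s y"

datatype prog =
    Skip | Instr instr | Seq prog prog | If test prog prog | While test prog

text \<open>\<open>run ic tc c s t s'\<close>: started in \<open>s\<close>, the program \<open>c\<close> halts in \<open>s'\<close> at total cost \<open>t\<close>, where
  \<open>ic\<close> and \<open>tc\<close> give the cost of executing an instruction and of evaluating a test in a state.\<close>

inductive run ::
  "(instr \<Rightarrow> state \<Rightarrow> nat) \<Rightarrow> (test \<Rightarrow> state \<Rightarrow> nat) \<Rightarrow> prog \<Rightarrow> state \<Rightarrow> nat \<Rightarrow> state \<Rightarrow> bool"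
  for ic :: "instr \<Rightarrow> state \<Rightarrow> nat" and tc :: "test \<Rightarrow> state \<Rightarrow> nat"
where
  Skip: "run ic tc Skip s 0 s"
| Instr: "run ic tc (Instr i) s (ic i s) (effect i s)"
| Seq: "run ic tc c1 s t1 s' \<Longrightarrow> run ic tc c2 s' t2 s'' \<Longrightarrow> run ic tc (Seq c1 c2) s (t1 + t2) s''"
| IfTrue: "holds b s \<Longrightarrow> run ic tc c1 s t s' \<Longrightarrow> run ic tc (If b c1 c2) s (tc b s + t) s'"
| IfFalse: "\<not> holds b s \<Longrightarrow> run ic tc c2 s t s' \<Longrightarrow> run ic tc (If b c1 c2) s (tc b s + t) s'"
| WhileFalse: "\<not> holds b s \<Longrightarrow> run ic tc (While b c) s (tc b s) s"
| WhileTrue: "holds b s \<Longrightarrow> run ic tc c s t1 s' \<Longrightarrow> run ic tc (While b c) s' t2 s'' \<Longrightarrow>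
    run ic tc (While b c) s (tc b s + t1 + t2) s''"

lemma run_deterministic:
  "run ic tc c s t s' \<Longrightarrow> run ic tc c s u s'' \<Longrightarrow> u = t \<and> s'' = s'"
proof (induction arbitrary: u s'' rule: run.induct)
  case Skip
  then show ?case by cases auto
next
  case Instr
  then show ?case by cases auto
next
  case Seq
  from Seq.prems show ?case by cases (use Seq.IH in blast)
next
  case IfTrue
  from IfTrue.prems show ?case by cases (use IfTrue in blast)+
next
  case IfFalse
  from IfFalse.prems show ?case by cases (use IfFalse in blast)+
next
  case WhileFalse
  from WhileFalse.prems show ?case by cases (use WhileFalse in auto)
next
  case WhileTrue
  from WhileTrue.prems show ?case by cases (use WhileTrue in blast)+
qed

subsection \<open>Unit cost and logarithmic cost\<close>

fun unit_instr_cost :: "instr \<Rightarrow> state \<Rightarrow> nat" where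
  "unit_instr_cost i s = 1"

fun unit_test_cost :: "test \<Rightarrow> state \<Rightarrow> nat" where
  "unit_test_cost b s = 1"

definition nat_size :: "nat \<Rightarrow> nat" where
  "nat_size k = 1 + floorlog 2 k"

text \<open>The encoding length of a rational number (numerator and denominator in lowest terms, in
  binary); used only for real numbers that are rational. On rational inputs all numbers
  in the machine stay rational.\<close>

definition real_size :: "real \<Rightarrow> nat" where
  "real_size x = (case quotient_of (THE r. of_rat r = x) of
     (a, b) \<Rightarrow> 1 + nat_size (nat \<bar>a\<bar>) + nat_size (nat b))"

fun log_instr_cost :: "instr \<Rightarrow> state \<Rightarrow> nat" where
  "log_instr_cost (NConst x k) s = nat_size k"
| "log_instr_cost (NCopy x y) s = nat_size (nreg s y)"
| "log_instr_cost (NAdd x y z) s = nat_size (nreg s y) + nat_size (nreg s z)"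
| "log_instr_cost (NSub x y z) s = nat_size (nreg s y) + nat_size (nreg s z)"
| "log_instr_cost (NLoad x y) s = nat_size (nreg s y) + nat_size (nmem s (nreg s y))"
| "log_instr_cost (NStore x y) s = nat_size (nreg s x) + nat_size (nreg s y)"
| "log_instr_cost (RConst x k) s = real_size (real_of_int k)"
| "log_instr_cost (RCopy x y) s = real_size (rreg s y)"
| "log_instr_cost (RAdd x y z) s = real_size (rreg s y) + real_size (rreg s z)"
| "log_instr_cost (RSub x y z) s = real_size (rreg s y) + real_size (rreg s z)"
| "log_instr_cost (RMul x y z) s = real_size (rreg s y) + real_size (rreg s z)"
| "log_instr_cost (RDiv x y z) s = real_size (rreg s y) + real_size (rreg s z)"
| "log_instr_cost (RLoad x y) s = nat_size (nreg s y) + real_size (rmem s (nreg s y))"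
| "log_instr_cost (RStore x y) s = nat_size (nreg s x) + real_size (rreg s y)"

fun log_test_cost :: "test \<Rightarrow> state \<Rightarrow> nat" where
  "log_test_cost (NLess x y) s = nat_size (nreg s x) + nat_size (nreg s y)"
| "log_test_cost (NEq x y) s = nat_size (nreg s x) + nat_size (nreg s y)"
| "log_test_cost (RLess x y) s = real_size (rreg s x) + real_size (rreg s y)"
| "log_test_cost (REq x y) s = real_size (rreg s x) + real_size (rreg s y)"

section \<open>Deciding a property of square matrices in polynomial time\<close>

text \<open>The order is in register 0, and the matrix is stored row by row in the real memory.\<close>

definition input_state :: "nat \<Rightarrow> real mat \<Rightarrow> state" where
  "input_state n A =
     \<lparr>nreg = (\<lambda>_. 0)(0 := n),
      nmem = (\<lambda>_. 0),
      rreg = (\<lambda>_. 0),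
      rmem = (\<lambda>a. if a < n * n then A $$ (a div n, a mod n) else 0)\<rparr>"

text \<open>The answer is left in register 0, as 1 for yes and 0 for no.\<close>

definition answers_within ::
  "(instr \<Rightarrow> state \<Rightarrow> nat) \<Rightarrow> (test \<Rightarrow> state \<Rightarrow> nat) \<Rightarrow> prog \<Rightarrow> state \<Rightarrow> bool \<Rightarrow> nat \<Rightarrow> bool" where
  "answers_within ic tc c s b T \<longleftrightarrow>
     (\<exists>t s'. run ic tc c s t s' \<and> t \<le> T \<and> nreg s' 0 = of_bool b)"

definition mat_size :: "nat \<Rightarrow> real mat \<Rightarrow> nat" where
  "mat_size n A = (\<Sum>i<n. \<Sum>j<n. real_size (A $$ (i, j)))"

text \<open>
  \<open>poly_time_decidable S Q\<close>: one program decides, for all \<open>n\<close> and all \<open>A \<in> S n\<close>, whether \<open>Q n A\<close>.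
  It is required to be polynomial in both standard senses: for arbitrary real entries the number of
  steps is polynomial in \<open>n\<close>, and for rational entries the bit complexity (logarithmic cost)
  is polynomial in the encoding length of the matrix, as for polynomial-time Turing machines.
\<close>

definition poly_time_decidable ::
  "(nat \<Rightarrow> real mat set) \<Rightarrow> (nat \<Rightarrow> real mat \<Rightarrow> bool) \<Rightarrow> bool" where
  "poly_time_decidable S Q \<longleftrightarrow>
     (\<exists>(c :: prog) (p :: nat poly) (q :: nat poly). \<forall>n. \<forall>A \<in> S n.
        answers_within unit_instr_cost unit_test_cost c (input_state n A) (Q n A) (poly p n) \<and>
        (elements_mat A \<subseteq> \<rat> \<longrightarrow>
         answers_within log_instr_cost log_test_cost c (input_state n A) (Q n A)
           (poly q (mat_size n A))))"

end

theory Submission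
  imports Defs
begin

text \<open>
  Call an index \<open>u\<close> dominated by \<open>v\<close> if \<open>A $$ (u, w) \<le> A $$ (v, w)\<close> for all \<open>w\<close> other than \<open>u\<close> and \<open>v\<close>.
  A simultaneous reordering of rows and columns is monotone off the diagonal iff every index is
  dominated by all later ones (\<open>monotone_mats_permuted_iff\<close>). For symmetric \<open>A\<close> domination
  is transitive (\<open>dominated_trans\<close>), hence a preorder. If it is total, sorting the indices by the
  number of indices that they dominate gives a monotone reordering; conversely, a monotone
  reordering makes any two indices comparable. So a reordering exists iff domination is total
  (\<open>monotone_reordering_iff_total\<close>), and no permutation has to be computed.

  Totality is a condition on quadruples of indices (\<open>total_iff_compatible\<close>), which four nested
  loops over the indices check in \<open>O(n\<^sup>4)\<close> steps (\<open>halts_decide_total\<close>). The program only adds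
  counters and compares entries of \<open>A\<close>. Its natural numbers therefore stay quadratic in \<open>n\<close> and
  its real numbers stay among 0 and the entries, so one step costs at most some \<open>K\<close>:
  1 under unit cost, and a linear function of the encoding length of \<open>A\<close> under logarithmic cost.
  Both time bounds follow from a single count of steps, multiplied by \<open>K\<close>.
\<close>

section \<open>The combinatorial criterion\<close>

text \<open>Row \<open>u\<close> is entrywise at most row \<open>v\<close>, outside of the two columns \<open>u\<close> and \<open>v\<close>, where one of
  the rows meets the diagonal.\<close>

definition dominated :: "nat \<Rightarrow> real mat \<Rightarrow> nat \<Rightarrow> nat \<Rightarrow> bool" where
  "dominated n A u v \<longleftrightarrow> (\<forall>w<n. w \<noteq> u \<and> w \<noteq> v \<longrightarrow> A $$ (u, w) \<le> A $$ (v, w))"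

lemma sym_mats_swap:
  assumes "A \<in> sym_mats n" "i < n" "j < n"
  shows "A $$ (i, j) = A $$ (j, i)"
proof -
  have "A \<in> carrier_mat n n" "transpose_mat A = A" using assms(1) by (auto simp: sym_mats_def)
  then show ?thesis using assms by (metis carrier_matD index_transpose_mat(1))
qed

lemma dominated_refl: "dominated n A u u"
  by (simp add: dominated_def)

text \<open>Symmetry is needed for the column \<open>v\<close>, in which neither assumption compares rows \<open>u\<close> and \<open>x\<close>:
  the entry at \<open>(u, v)\<close> is at most the one at \<open>(u, x)\<close>, which is at most the one at \<open>(v, x)\<close>.\<close>

lemma dominated_trans:
  assumes A: "A \<in> sym_mats n" and lt: "u < n" "v < n" "x < n"
    and uv: "dominated n A u v" and vx: "dominated n A v x"
  shows "dominated n A u x"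
proof (cases "u = v \<or> v = x \<or> u = x")
  case True
  then show ?thesis using uv vx dominated_refl by auto
next
  case False
  show ?thesis unfolding dominated_def
  proof (intro allI impI)
    fix w assume w: "w < n" "w \<noteq> u \<and> w \<noteq> x"
    show "A $$ (u, w) \<le> A $$ (x, w)"
    proof (cases "w = v")
      case True
      have "A $$ (u, v) = A $$ (v, u)" using sym_mats_swap[OF A] lt by simp
      also have "\<dots> \<le> A $$ (x, u)" using vx lt False by (auto simp: dominated_def)
      also have "\<dots> = A $$ (u, x)" using sym_mats_swap[OF A] lt by simp
      also have "\<dots> \<le> A $$ (v, x)" using uv lt False by (auto simp: dominated_def)
      also have "\<dots> = A $$ (x, v)" using sym_mats_swap[OF A] lt by simp
      finally show ?thesis using True by simp
    next
      case False
      then show ?thesis using uv vx w unfolding dominated_def by (meson order_trans)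
    qed
  qed
qed

lemma conjugate_permutation_mat:
  fixes A :: "real mat"
  assumes A: "A \<in> carrier_mat n n" and \<pi>: "\<pi> permutes {..<n}"
  defines "P \<equiv> mat n n (\<lambda>(i, j). if i = \<pi> j then 1 else 0)"
  shows "transpose_mat P * A * P = mat n n (\<lambda>(i, j). A $$ (\<pi> i, \<pi> j))"
proof (rule eq_matI)
  fix i j assume "i < dim_row (mat n n (\<lambda>(i, j). A $$ (\<pi> i, \<pi> j)))"
    "j < dim_col (mat n n (\<lambda>(i, j). A $$ (\<pi> i, \<pi> j)))"
  then have ij: "i < n" "j < n" by auto
  have lt: "\<pi> i < n" "\<pi> j < n" using permutes_in_image[OF \<pi>] ij by auto
  have P: "P \<in> carrier_mat n n" by (simp add: P_def)
  have entry: "(B * C) $$ (i, k) = (\<Sum>l<n. B $$ (i, l) * C $$ (l, k))"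
    if "k < n" "B \<in> carrier_mat n n" "C \<in> carrier_mat n n" for B C :: "real mat" and k
    using that ij by (simp add: scalar_prod_def atLeast0LessThan)
  have left: "(transpose_mat P * A) $$ (i, k) = A $$ (\<pi> i, k)" if "k < n" for k
  proof -
    have "(transpose_mat P * A) $$ (i, k) = (\<Sum>l<n. transpose_mat P $$ (i, l) * A $$ (l, k))"
      using A P that by (intro entry) auto
    also have "\<dots> = (\<Sum>l<n. if l = \<pi> i then A $$ (l, k) else 0)"
      using ij by (intro sum.cong) (auto simp: P_def)
    also have "\<dots> = A $$ (\<pi> i, k)" using lt by (simp add: sum.delta)
    finally show ?thesis .
  qed
  have "(transpose_mat P * A * P) $$ (i, j)
      = (\<Sum>k<n. (transpose_mat P * A) $$ (i, k) * P $$ (k, j))"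
    using A P ij by (intro entry) auto
  also have "\<dots> = (\<Sum>k<n. if k = \<pi> j then A $$ (\<pi> i, k) else 0)"
    using ij by (intro sum.cong refl) (simp add: left, simp add: P_def)
  also have "\<dots> = A $$ (\<pi> i, \<pi> j)" using lt by (simp add: sum.delta)
  finally show "(transpose_mat P * A * P) $$ (i, j) = mat n n (\<lambda>(i, j). A $$ (\<pi> i, \<pi> j)) $$ (i, j)"
    using ij by simp
qed (auto simp: P_def)

text \<open>Comparisons within one column, or by symmetry within one row, suffice. Above the
  diagonal, one gets from \<open>(i, j)\<close> to \<open>(k, l)\<close> by
  first moving right to \<open>(i, l)\<close> and then down, without meeting the diagonal since \<open>i \<le> k < l\<close>.\<close>

lemma monotone_mats_permuted_iff:
  assumes A: "A \<in> sym_mats n" and \<pi>: "\<pi> permutes {..<n}"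
  shows "mat n n (\<lambda>(i, j). A $$ (\<pi> i, \<pi> j)) \<in> monotone_mats n
    \<longleftrightarrow> (\<forall>i<n. \<forall>j<n. i \<le> j \<longrightarrow> dominated n A (\<pi> i) (\<pi> j))"
    (is "?B \<in> _ \<longleftrightarrow> ?dom")
proof
  have lt: "\<pi> i < n" if "i < n" for i using permutes_in_image[OF \<pi>] that by auto
  {
    assume B: "?B \<in> monotone_mats n"
    show ?dom unfolding dominated_def
    proof (intro allI impI)
      fix i j w assume *: "i < n" "j < n" "i \<le> j" "w < n" "w \<noteq> \<pi> i \<and> w \<noteq> \<pi> j"
      obtain k where k: "k < n" "w = \<pi> k"
        using permutes_image[OF \<pi>] \<open>w < n\<close> by (metis imageE lessThan_iff)
      have "k \<noteq> i" "k \<noteq> j" using * k by auto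
      then have "?B $$ (i, k) \<le> ?B $$ (j, k)"
        using B * k(1) unfolding monotone_mats_def by blast
      then show "A $$ (\<pi> i, w) \<le> A $$ (\<pi> j, w)" using * k by simp
    qed
  }
  assume dom: ?dom
  have inj: "\<pi> i = \<pi> j \<longleftrightarrow> i = j" for i j using permutes_inj[OF \<pi>] by (auto dest: injD)
  have step: "?B $$ (i, k) \<le> ?B $$ (j, k)" if "i < n" "j < n" "k < n" "i \<le> j" "k \<noteq> i" "k \<noteq> j"
    for i j k
    using dom that lt inj by (auto simp: dominated_def)
  have B_sym: "?B \<in> sym_mats n"
    using sym_mats_swap[OF A] lt by (auto simp: sym_mats_def intro!: eq_matI)
  note swap = sym_mats_swap[OF B_sym]
  have upper: "?B $$ (i, j) \<le> ?B $$ (k, l)"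
    if "i < n" "j < n" "k < n" "l < n" "i \<le> k" "j \<le> l" "i < j" "k < l" for i j k l
  proof -
    have "?B $$ (j, i) \<le> ?B $$ (l, i)" using step[of j l i] that by auto
    moreover have "?B $$ (i, l) \<le> ?B $$ (k, l)" using step[of i k l] that by auto
    ultimately show ?thesis using swap[of i j] swap[of i l] that by linarith
  qed
  have "?B $$ (i, j) \<le> ?B $$ (k, l)"
    if "i < n" "j < n" "k < n" "l < n" "i \<le> k \<and> j \<le> l \<and> i \<noteq> j \<and> k \<noteq> l" for i j k l
  proof -
    have "(i < j \<or> j < i) \<and> (k < l \<or> l < k)" using that by auto
    then consider "i < j" "k < l" | "i < j" "l < k" | "j < i" "k < l" | "j < i" "l < k"
      by blast
    then show ?thesis
    proof cases
      case 1 then show ?thesis using upper[of i j k l] that by auto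
    next
      case 2 then show ?thesis using upper[of i j l k] swap[of k l] that by auto
    next
      case 3 then show ?thesis using upper[of j i k l] swap[of i j] that by auto
    next
      case 4 then show ?thesis using upper[of j i l k] swap[of i j] swap[of k l] that by auto
    qed
  qed
  then show "?B \<in> monotone_mats n" using B_sym unfolding monotone_mats_def by blast
qed

lemma sorting_permutation_exists:
  fixes f :: "nat \<Rightarrow> nat"
  obtains \<pi> where "\<pi> permutes {..<n}" "\<And>i j. i \<le> j \<Longrightarrow> j < n \<Longrightarrow> f (\<pi> i) \<le> f (\<pi> j)"
proof -
  define xs where "xs = sort_key f [0..<n]"
  have xs: "length xs = n" "distinct xs" "set xs = {..<n}" "sorted (map f xs)"
    by (auto simp: xs_def)
  define \<pi> where "\<pi> = (\<lambda>i. if i < n then xs ! i else i)"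
  have "bij_betw (\<lambda>i. xs ! i) {..<n} {..<n}"
    using xs by (intro bij_betw_nth) simp_all
  then have "bij_betw \<pi> {..<n} {..<n}"
    by (rule bij_betw_cong[THEN iffD1, rotated]) (auto simp: \<pi>_def)
  then have "\<pi> permutes {..<n}"
    by (rule bij_imp_permutes) (auto simp: \<pi>_def)
  moreover have "f (\<pi> i) \<le> f (\<pi> j)" if "i \<le> j" "j < n" for i j
    using sorted_nth_mono[OF xs(4), of i j] that xs(1) by (auto simp: \<pi>_def)
  ultimately show ?thesis by (rule that)
qed

theorem monotone_reordering_iff_total:
  assumes A: "A \<in> sym_mats n"
  shows "(\<exists>P \<in> permutation_mats n. transpose_mat P * A * P \<in> monotone_mats n)
    \<longleftrightarrow> (\<forall>u<n. \<forall>v<n. dominated n A u v \<or> dominated n A v u)"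
proof -
  have carrier: "A \<in> carrier_mat n n" using A by (auto simp: sym_mats_def)
  have "(\<exists>P \<in> permutation_mats n. transpose_mat P * A * P \<in> monotone_mats n)
    \<longleftrightarrow> (\<exists>\<pi>. \<pi> permutes {..<n} \<and> mat n n (\<lambda>(i, j). A $$ (\<pi> i, \<pi> j)) \<in> monotone_mats n)"
    using conjugate_permutation_mat[OF carrier] unfolding permutation_mats_def by fastforce
  also have "\<dots> \<longleftrightarrow> (\<exists>\<pi>. \<pi> permutes {..<n} \<and>
      (\<forall>i<n. \<forall>j<n. i \<le> j \<longrightarrow> dominated n A (\<pi> i) (\<pi> j)))"
    using monotone_mats_permuted_iff[OF A] by blast
  also have "\<dots> \<longleftrightarrow> (\<forall>u<n. \<forall>v<n. dominated n A u v \<or> dominated n A v u)" (is "_ \<longleftrightarrow> ?total")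
  proof
    assume "\<exists>\<pi>. \<pi> permutes {..<n} \<and> (\<forall>i<n. \<forall>j<n. i \<le> j \<longrightarrow> dominated n A (\<pi> i) (\<pi> j))"
    then obtain \<pi> where \<pi>: "\<pi> permutes {..<n}"
      and dom: "\<And>i j. i < n \<Longrightarrow> j < n \<Longrightarrow> i \<le> j \<Longrightarrow> dominated n A (\<pi> i) (\<pi> j)" by blast
    show ?total
    proof (intro allI impI)
      fix u v assume "u < n" "v < n"
      then obtain i j where "i < n" "u = \<pi> i" "j < n" "v = \<pi> j"
        using permutes_image[OF \<pi>] by (metis imageE lessThan_iff)
      then show "dominated n A u v \<or> dominated n A v u"
        using dom[of i j] dom[of j i] by (cases "i \<le> j") auto
    qed
  next
    assume total: ?total
    \<comment> \<open>Given totality, sizes of down-sets compare exactly as domination does.\<close>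
    define down where "down u = {v. v < n \<and> dominated n A v u}" for u
    have fin: "finite (down u)" for u by (auto simp: down_def)
    have rank: "dominated n A u v" if "u < n" "v < n" "card (down u) \<le> card (down v)" for u v
    proof (rule ccontr)
      assume not: "\<not> dominated n A u v"
      then have "dominated n A v u" using total that by blast
      then have "down v \<subseteq> down u" using dominated_trans[OF A, of _ v u] that unfolding down_def by blast
      moreover have "u \<in> down u" "u \<notin> down v" using that not dominated_refl by (auto simp: down_def)
      ultimately have "card (down v) < card (down u)" using fin by (intro psubset_card_mono) auto
      then show False using that by simp
    qed
    obtain \<pi> where \<pi>: "\<pi> permutes {..<n}"
      and sorted: "\<And>i j. i \<le> j \<Longrightarrow> j < n \<Longrightarrow> card (down (\<pi> i)) \<le> card (down (\<pi> j))"
      using sorting_permutation_exists[of n "\<lambda>u. card (down u)"] by blast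
    have "\<pi> i < n" if "i < n" for i using permutes_in_image[OF \<pi>] that by auto
    then show "\<exists>\<pi>. \<pi> permutes {..<n} \<and> (\<forall>i<n. \<forall>j<n. i \<le> j \<longrightarrow> dominated n A (\<pi> i) (\<pi> j))"
      using \<pi> sorted rank by blast
  qed
  finally show ?thesis .
qed

section \<open>Step counting for programs\<close>

text \<open>The invariant that makes all steps cheap: counters and addresses are at most quadratic in \<open>n\<close>,
  all real numbers are 0 or entries of \<open>A\<close>, and the stored matrix is untouched.\<close>

definition bounded_state :: "nat \<Rightarrow> real mat \<Rightarrow> state \<Rightarrow> bool" where
  "bounded_state n A s \<longleftrightarrow>
     (\<forall>r. nreg s r \<le> n * n + n + 1) \<and>
     (\<forall>r. rreg s r \<in> insert 0 (elements_mat A)) \<and>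
     rmem s = rmem (input_state n A)"

text \<open>The kinds of instruction that the program uses. Their operands are bounded in every bounded
  state; the natural-number memory, which \<open>bounded_state\<close> does not constrain, is not accessed.\<close>

fun simple_instr :: "instr \<Rightarrow> bool" where
  "simple_instr (NConst x k) \<longleftrightarrow> k \<le> 1"
| "simple_instr (NCopy x y) \<longleftrightarrow> True"
| "simple_instr (NAdd x y z) \<longleftrightarrow> True"
| "simple_instr (RLoad x y) \<longleftrightarrow> True"
| "simple_instr _ \<longleftrightarrow> False"

text \<open>A cost measure under which each simple instruction and each test costs at most \<open>K\<close> in bounded
  states.\<close>

locale bounded_cost =
  fixes ic :: "instr \<Rightarrow> state \<Rightarrow> nat" and tc :: "test \<Rightarrow> state \<Rightarrow> nat"
    and n :: nat and A :: "real mat" and K :: nat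
  assumes carrier: "A \<in> carrier_mat n n"
    and instr_cost: "bounded_state n A s \<Longrightarrow> simple_instr i \<Longrightarrow> ic i s \<le> K"
    and test_cost: "bounded_state n A s \<Longrightarrow> tc b s \<le> K"
begin

text \<open>Started in \<open>s\<close>, the program halts in a state satisfying \<open>R\<close>, at total cost at most
  \<open>T * K\<close>, the price of \<open>T\<close> steps.\<close>

definition halts :: "prog \<Rightarrow> state \<Rightarrow> nat \<Rightarrow> (state \<Rightarrow> bool) \<Rightarrow> bool" where
  "halts c s T R \<longleftrightarrow> (\<exists>t s'. run ic tc c s t s' \<and> t \<le> T * K \<and> R s')"

lemma haltsI: "run ic tc c s t s' \<Longrightarrow> t \<le> T * K \<Longrightarrow> R s' \<Longrightarrow> halts c s T R"
  unfolding halts_def by blast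

lemma haltsE:
  assumes "halts c s T R"
  obtains t s' where "run ic tc c s t s'" "t \<le> T * K" "R s'"
  using assms unfolding halts_def by blast

lemma halts_weaken:
  assumes "halts c s T R" "T \<le> T'" "\<And>s'. R s' \<Longrightarrow> R' s'"
  shows "halts c s T' R'"
proof -
  have "T * K \<le> T' * K" using assms(2) by simp
  then show ?thesis using assms(1,3) by (elim haltsE) (blast intro: haltsI order_trans)
qed

lemma halts_Skip: "R s \<Longrightarrow> halts Skip s T R"
  by (rule haltsI[OF run.Skip]) auto

lemma halts_Instr:
  "simple_instr i \<Longrightarrow> bounded_state n A s \<Longrightarrow> R (effect i s) \<Longrightarrow> halts (Instr i) s 1 R"
  by (rule haltsI[OF run.Instr]) (auto intro: instr_cost)

lemma halts_Seq:
  assumes "halts c1 s T1 (\<lambda>s'. halts c2 s' T2 R)"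
  shows "halts (Seq c1 c2) s (T1 + T2) R"
  using assms by (elim haltsE) (auto intro!: haltsI[OF run.Seq] simp: distrib_right)

lemma halts_If:
  assumes s: "bounded_state n A s"
    and branches: "holds b s \<Longrightarrow> halts c1 s T R" "\<not> holds b s \<Longrightarrow> halts c2 s T R"
  shows "halts (If b c1 c2) s (1 + T) R"
proof (cases "holds b s")
  case True
  from branches(1)[OF True] show ?thesis
    using test_cost[OF s, of b]
    by (elim haltsE) (auto intro!: haltsI[OF run.IfTrue[OF True]] simp: distrib_right)
next
  case False
  from branches(2)[OF False] show ?thesis
    using test_cost[OF s, of b]
    by (elim haltsE) (auto intro!: haltsI[OF run.IfFalse[OF False]] simp: distrib_right)
qed

lemma halts_While_exit:
  assumes "bounded_state n A s" "\<not> holds b s" "R s"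
  shows "halts (While b c) s 1 R"
  using assms test_cost[of s b] by (intro haltsI[OF run.WhileFalse]) auto

lemma halts_While_iterate:
  assumes s: "bounded_state n A s" and b: "holds b s"
    and c: "halts c s T1 (\<lambda>s'. halts (While b c) s' T2 R)"
  shows "halts (While b c) s (1 + T1 + T2) R"
proof -
  obtain t1 s1 t2 s2 where *: "run ic tc c s t1 s1" "t1 \<le> T1 * K"
    "run ic tc (While b c) s1 t2 s2" "t2 \<le> T2 * K" "R s2"
    using c by (elim haltsE)
  have "tc b s + t1 + t2 \<le> (1 + T1 + T2) * K"
    using test_cost[OF s, of b] *(2,4) by (simp add: distrib_right)
  then show ?thesis using *(5) by (intro haltsI[OF run.WhileTrue[OF b *(1,3)]])
qed

text \<open>The register convention of the program: register 0 holds \<open>n\<close>, register 1 holds 1, register 2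
  holds the current answer \<open>ok\<close>, and \<open>L\<close> lists loop registers with their current values.\<close>

definition layout :: "bool \<Rightarrow> (nat \<times> nat) list \<Rightarrow> state \<Rightarrow> bool" where
  "layout ok L s \<longleftrightarrow> bounded_state n A s \<and> nreg s 0 = n \<and> nreg s 1 = 1 \<and>
     nreg s 2 = of_bool ok \<and> (\<forall>(r, k) \<in> set L. nreg s r = k)"

end

text \<open>Execute the body for each index from 0 to \<open>n - 1\<close>. Register \<open>r\<close> holds the index and register \<open>m\<close>
  the index times \<open>n\<close>, the address at which the row begins: there is no multiplication of natural
  numbers, so the address is updated by addition.\<close>

definition for_rows :: "nat \<Rightarrow> nat \<Rightarrow> prog \<Rightarrow> prog" where
  "for_rows r m body =
     Seq (Instr (NConst r 0)) (Seq (Instr (NConst m 0))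
       (While (NLess r 0) (Seq body (Seq (Instr (NAdd r r 1)) (Instr (NAdd m m 0))))))"

text \<open>A bound on the steps of \<open>for_rows\<close> when the body takes at most \<open>T\<close> steps: two initialisations
  and the failing test, and \<open>n\<close> rounds of a test, the body and two additions.\<close>

definition for_steps :: "nat \<Rightarrow> nat \<Rightarrow> nat" where
  "for_steps n T = 3 + n * (T + 3)"

context bounded_cost
begin

lemma layout_bounded: "layout ok L s \<Longrightarrow> bounded_state n A s"
  by (simp add: layout_def)

lemma layout_set:
  assumes "layout ok L s" "r \<notin> {0, 1, 2}" "r \<notin> fst ` set L" "k \<le> n * n + n + 1"
  shows "layout ok ((r, k) # L) (s\<lparr>nreg := (nreg s)(r := k)\<rparr>)"
proof -
  have "r' \<noteq> r" if "(r', k') \<in> set L" for r' k' using that assms(3) by force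
  then show ?thesis using assms unfolding layout_def bounded_state_def by auto
qed

lemma layout_update:
  assumes "layout ok ((r, j) # L) s" "r \<notin> {0, 1, 2}" "r \<notin> fst ` set L" "k \<le> n * n + n + 1"
  shows "layout ok ((r, k) # L) (s\<lparr>nreg := (nreg s)(r := k)\<rparr>)"
  using assms by (intro layout_set) (auto simp: layout_def)

lemma layout_swap: "layout ok (p # q # L) s \<longleftrightarrow> layout ok (q # p # L) s"
  by (auto simp: layout_def)

lemma layout_drop: "layout ok (p # L) s \<Longrightarrow> layout ok L s"
  by (auto simp: layout_def)

text \<open>A loop whose body conjoins the answer with \<open>P i\<close> conjoins it with \<open>P i\<close> for all \<open>i < n\<close>. The
  loop registers are preserved up to those of this loop, so that the rule can be nested.\<close>

lemma halts_for_rows: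
  assumes body: "\<And>i ok s. i < n \<Longrightarrow> layout ok ((r, i) # (m, i * n) # L) s \<Longrightarrow>
      halts body s T (layout (ok \<and> P i) ((r, i) # (m, i * n) # L))"
    and fresh: "r \<notin> {0, 1, 2}" "m \<notin> {0, 1, 2}" "r \<noteq> m" "r \<notin> fst ` set L" "m \<notin> fst ` set L"
    and s: "layout ok L s"
  shows "halts (for_rows r m body) s (for_steps n T) (layout (ok \<and> (\<forall>i<n. P i)) L)"
proof -
  let ?inv = "\<lambda>i. layout (ok \<and> (\<forall>j<i. P j)) ((r, i) # (m, i * n) # L)"
  let ?R = "layout (ok \<and> (\<forall>i<n. P i)) L"
  let ?c = "Seq body (Seq (Instr (NAdd r r 1)) (Instr (NAdd m m 0)))"
  have loop: "halts (While (NLess r 0) ?c) s (1 + d * (T + 3)) ?R"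
    if "?inv (n - d) s" "d \<le> n" for d s
    using that
  proof (induction d arbitrary: s)
    case 0
    then have "layout (ok \<and> (\<forall>i<n. P i)) L s" by (auto dest: layout_drop)
    moreover have "\<not> holds (NLess r 0) s" using 0 by (simp add: layout_def)
    ultimately show ?case using halts_While_exit[of s "NLess r 0" ?R] layout_bounded by simp
  next
    case (Suc d)
    define i where "i = n - Suc d"
    have i: "i < n" "Suc i = n - d" using Suc.prems(2) by (auto simp: i_def)
    then have "Suc i * n \<le> n * n" by (intro mult_right_mono) auto
    then have le: "Suc i \<le> n * n + n + 1" "Suc i * n \<le> n * n + n + 1" using i(1) by auto
    have all: "(ok \<and> (\<forall>j<i. P j)) \<and> P i \<longleftrightarrow> ok \<and> (\<forall>j<Suc i. P j)"
      by (auto simp: less_Suc_eq)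
    have tail: "halts (Seq (Instr (NAdd r r 1)) (Instr (NAdd m m 0))) s1 (1 + 1)
        (\<lambda>s'. halts (While (NLess r 0) ?c) s' (1 + d * (T + 3)) ?R)"
      if s1: "layout ((ok \<and> (\<forall>j<i. P j)) \<and> P i) ((r, i) # (m, i * n) # L) s1" for s1
    proof -
      define s2 where "s2 = effect (NAdd r r 1) s1"
      define s3 where "s3 = effect (NAdd m m 0) s2"
      have v1: "nreg s1 r = i" "nreg s1 1 = 1" using s1 by (auto simp: layout_def)
      have l2: "layout (ok \<and> (\<forall>j<Suc i. P j)) ((r, Suc i) # (m, i * n) # L) s2"
        using layout_update[OF s1, of "Suc i"] le fresh v1 unfolding all s2_def by auto
      have v2: "nreg s2 m = i * n" "nreg s2 0 = n" using l2 by (auto simp: layout_def)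
      have "layout (ok \<and> (\<forall>j<Suc i. P j)) ((m, Suc i * n) # (r, Suc i) # L) s3"
        using layout_update[of _ m "i * n" "(r, Suc i) # L" s2 "Suc i * n"] l2 layout_swap
          le fresh v2 unfolding s3_def by (simp add: add.commute)
      then have "?inv (n - d) s3" unfolding i(2)[symmetric] by (subst layout_swap)
      then have "halts (While (NLess r 0) ?c) s3 (1 + d * (T + 3)) ?R"
        using Suc.IH Suc.prems(2) by simp
      then show ?thesis
        using layout_bounded[OF s1] layout_bounded[OF l2] unfolding s3_def s2_def
        by (intro halts_Seq halts_Instr) auto
    qed
    have s: "layout (ok \<and> (\<forall>j<i. P j)) ((r, i) # (m, i * n) # L) s"
      using Suc.prems(1) by (simp add: i_def)
    have "halts ?c s (T + (1 + 1)) (\<lambda>s'. halts (While (NLess r 0) ?c) s' (1 + d * (T + 3)) ?R)"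
      by (rule halts_Seq, rule halts_weaken[OF body[OF i(1) s] order_refl tail])
    moreover have "holds (NLess r 0) s" using s i(1) by (simp add: layout_def)
    ultimately have "halts (While (NLess r 0) ?c) s (1 + (T + (1 + 1)) + (1 + d * (T + 3))) ?R"
      using layout_bounded[OF s] by (intro halts_While_iterate)
    then show ?case by (rule halts_weaken) auto
  qed
  define s1 where "s1 = effect (NConst r 0) s"
  define s2 where "s2 = effect (NConst m 0) s1"
  have l1: "layout ok ((r, 0) # L) s1"
    using layout_set[OF s, of r 0] fresh unfolding s1_def by simp
  have l2: "?inv 0 s2"
    using layout_set[OF l1, of m 0] fresh unfolding s2_def by (subst layout_swap) simp
  have "halts (While (NLess r 0) ?c) s2 (1 + n * (T + 3)) ?R"
    using loop[of n s2] l2 by simp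
  then have "halts (for_rows r m body) s (1 + (1 + (1 + n * (T + 3)))) ?R"
    unfolding for_rows_def using layout_bounded[OF s] layout_bounded[OF l1]
    by (intro halts_Seq halts_Instr) (auto simp: s1_def s2_def)
  then show ?thesis by (rule halts_weaken) (auto simp: for_steps_def)
qed

end

section \<open>The decision program\<close>

text \<open>Load into the real register \<open>x\<close> the entry in the row starting at the address in
  register \<open>m\<close> and the column in register \<open>r\<close>. Register 11 is scratch space.\<close>

definition load_entry :: "nat \<Rightarrow> nat \<Rightarrow> nat \<Rightarrow> prog" where
  "load_entry x m r = Seq (Instr (NAdd 11 m r)) (Instr (RLoad x 11))"

text \<open>Registers 3, 5, 7 and 9 hold indices \<open>u\<close>, \<open>v\<close>, \<open>w\<close> and \<open>x\<close>; registers 4 and 6 hold the addresses of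
  the rows \<open>u\<close> and \<open>v\<close>. The entries at \<open>(u, w)\<close>, \<open>(v, w)\<close>, \<open>(u, x)\<close> and \<open>(v, x)\<close> are loaded and
  the answer is cleared if they show that neither of \<open>u\<close> and \<open>v\<close> dominates the other.\<close>

definition check_quadruple :: prog where
  "check_quadruple =
     Seq (load_entry 0 4 7) (Seq (load_entry 1 6 7) (Seq (load_entry 2 4 9) (Seq (load_entry 3 6 9)
       (If (NEq 7 3) Skip (If (NEq 7 5) Skip (If (NEq 9 3) Skip (If (NEq 9 5) Skip
         (If (RLess 0 1) (If (RLess 3 2) (Instr (NConst 2 0)) Skip) Skip))))))))"

definition decide_total :: prog where
  "decide_total =
     Seq (Instr (NConst 1 1)) (Seq (Instr (NConst 2 1))
       (Seq (for_rows 3 4 (for_rows 5 6 (for_rows 7 8 (for_rows 9 10 check_quadruple))))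
         (Instr (NCopy 0 2))))"

text \<open>The constant 15 is the number of steps of \<open>check_quadruple\<close>: 8 for the loads and at most 7 for
  the tests and the assignment.\<close>

definition decide_steps :: "nat \<Rightarrow> nat" where
  "decide_steps n = 3 + for_steps n (for_steps n (for_steps n (for_steps n 15)))"

text \<open>The columns \<open>w\<close> and \<open>x\<close> do not witness that \<open>u\<close> and \<open>v\<close> are incomparable.\<close>

definition compatible :: "real mat \<Rightarrow> nat \<Rightarrow> nat \<Rightarrow> nat \<Rightarrow> nat \<Rightarrow> bool" where
  "compatible A u v w x \<longleftrightarrow>
     \<not> (w \<noteq> u \<and> w \<noteq> v \<and> x \<noteq> u \<and> x \<noteq> v \<and>
        A $$ (u, w) < A $$ (v, w) \<and> A $$ (v, x) < A $$ (u, x))"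

lemma total_iff_compatible:
  "(\<forall>u<n. \<forall>v<n. dominated n A u v \<or> dominated n A v u)
    \<longleftrightarrow> (\<forall>u<n. \<forall>v<n. \<forall>w<n. \<forall>x<n. compatible A u v w x)"
  unfolding dominated_def compatible_def by (meson not_le)

lemma rmem_input_state:
  assumes "u < n" "w < n"
  shows "rmem (input_state n A) (u * n + w) = A $$ (u, w)"
proof -
  have "u * n + w < Suc u * n" using assms by simp
  also have "\<dots> \<le> n * n" using assms by (intro mult_right_mono) auto
  finally show ?thesis using assms by (simp add: input_state_def)
qed

context bounded_cost
begin

lemma halts_load_entry:
  assumes s: "layout ok L s" and r: "nreg s m = u * n" "nreg s r = w"
    and lt: "u < n" "w < n" and L: "11 \<notin> fst ` set L"
    and R: "\<And>s'. layout ok L s' \<Longrightarrow> rreg s' = (rreg s)(x := A $$ (u, w)) \<Longrightarrow> R s'"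
  shows "halts (load_entry x m r) s 2 R"
proof -
  have "u * n + w < Suc u * n" using lt by simp
  also have "\<dots> \<le> n * n" using lt by (intro mult_right_mono) auto
  finally have le: "u * n + w \<le> n * n + n + 1" by simp
  define s1 where "s1 = effect (NAdd 11 m r) s"
  have "layout ok ((11, u * n + w) # L) s1"
    using layout_set[OF s, of 11 "u * n + w"] le L r unfolding s1_def by simp
  then have s1: "layout ok L s1" "nreg s1 11 = u * n + w" by (auto simp: layout_def)
  have entry: "rmem s1 (u * n + w) = A $$ (u, w)"
    using s1(1) rmem_input_state[OF lt] by (simp add: layout_def bounded_state_def)
  have "A $$ (u, w) \<in> elements_mat A" using carrier lt by (intro elements_matI) auto
  then have "layout ok L (effect (RLoad x 11) s1)"
    using s1 entry by (auto simp: layout_def bounded_state_def)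
  moreover have "rreg (effect (RLoad x 11) s1) = (rreg s)(x := A $$ (u, w))"
    using s1(2) entry by (simp add: s1_def)
  ultimately have "R (effect (RLoad x 11) s1)" by (rule R)
  then have "halts (load_entry x m r) s (1 + 1) R"
    unfolding load_entry_def using layout_bounded[OF s] layout_bounded[OF s1(1)]
    by (intro halts_Seq halts_Instr) (auto simp: s1_def)
  then show ?thesis by (simp add: numeral_2_eq_2)
qed

lemma layout_clear:
  assumes "layout ok L s" "2 \<notin> fst ` set L"
  shows "layout False L (s\<lparr>nreg := (nreg s)(2 := 0)\<rparr>)"
proof -
  have "r \<noteq> 2" if "(r, k) \<in> set L" for r k using that assms(2) by force
  then show ?thesis using assms(1) unfolding layout_def bounded_state_def by auto
qed

lemma halts_check_quadruple:
  assumes lt: "u < n" "v < n" "w < n" "x < n"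
    and L: "L = [(9, x), (10, x * n), (7, w), (8, w * n), (5, v), (6, v * n), (3, u), (4, u * n)]"
    and s: "layout ok L s"
  shows "halts check_quadruple s 15 (layout (ok \<and> compatible A u v w x) L)"
proof -
  let ?R = "layout (ok \<and> compatible A u v w x) L"
  let ?tests = "If (NEq 7 3) Skip (If (NEq 7 5) Skip (If (NEq 9 3) Skip (If (NEq 9 5) Skip
    (If (RLess 0 1) (If (RLess 3 2) (Instr (NConst 2 0)) Skip) Skip))))"
  have regs: "nreg s' 3 = u" "nreg s' 4 = u * n" "nreg s' 5 = v" "nreg s' 6 = v * n"
    "nreg s' 7 = w" "nreg s' 9 = x" if "layout ok L s'" for s'
    using that unfolding layout_def L by auto
  have fresh: "11 \<notin> fst ` set L" "2 \<notin> fst ` set L" by (auto simp: L)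
  note load = halts_load_entry[OF _ _ _ _ _ fresh(1)]
  \<comment> \<open>Six nested tests around one assignment; branches that skip need no steps.\<close>
  have tests: "halts ?tests s' (1 + (1 + (1 + (1 + (1 + (1 + 1)))))) ?R"
    if s': "layout ok L s'" and rreg: "rreg s' 0 = A $$ (u, w)" "rreg s' 1 = A $$ (v, w)"
      "rreg s' 2 = A $$ (u, x)" "rreg s' 3 = A $$ (v, x)" for s'
    by (intro halts_If halts_Skip halts_Instr layout_bounded[OF s'])
      (use s' layout_clear[OF s' fresh(2)] in \<open>auto simp: regs[OF s'] rreg rreg(2)[simplified] compatible_def\<close>)
  have "halts check_quadruple s (2 + (2 + (2 + (2 + (1 + (1 + (1 + (1 + (1 + (1 + 1)))))))))) ?R"
    unfolding check_quadruple_def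
    apply (rule halts_Seq, rule load[OF s _ _ lt(1,3)], rule regs[OF s], rule regs[OF s])
    apply (rule halts_Seq, rule load[OF _ _ _ lt(2,3)], assumption, erule regs, erule regs)
    apply (rule halts_Seq, rule load[OF _ _ _ lt(1,4)], assumption, erule regs, erule regs)
    apply (rule halts_Seq, rule load[OF _ _ _ lt(2,4)], assumption, erule regs, erule regs)
    apply (rule tests, assumption, simp_all)
    done
  then show ?thesis by simp
qed

lemma halts_decide_total:
  "halts decide_total (input_state n A) (decide_steps n)
     (\<lambda>s. nreg s 0 = of_bool (\<forall>u<n. \<forall>v<n. \<forall>w<n. \<forall>x<n. compatible A u v w x))"
proof -
  define s1 where "s1 = effect (NConst 1 1) (input_state n A)"
  define s2 where "s2 = effect (NConst 2 1) s1"
  let ?loops = "for_rows 3 4 (for_rows 5 6 (for_rows 7 8 (for_rows 9 10 check_quadruple)))"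
  let ?ok = "\<forall>u<n. \<forall>v<n. \<forall>w<n. \<forall>x<n. compatible A u v w x"
  let ?T = "for_steps n (for_steps n (for_steps n (for_steps n 15)))"
  have bounded: "bounded_state n A (input_state n A)" "bounded_state n A s1"
    by (auto simp: bounded_state_def input_state_def s1_def)
  have s2: "layout True [] s2"
    by (auto simp: layout_def bounded_state_def input_state_def s1_def s2_def)
  have "halts ?loops s2 ?T (layout (True \<and> ?ok) [])"
    by (intro halts_for_rows halts_check_quadruple s2) auto
  moreover have "halts (Instr (NCopy 0 2)) s 1 (\<lambda>s. nreg s 0 = of_bool ?ok)"
    if "layout (True \<and> ?ok) [] s" for s
    using that by (intro halts_Instr layout_bounded[OF that]) (simp_all add: layout_def)
  ultimately have "halts (Seq ?loops (Instr (NCopy 0 2))) s2 (?T + 1)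
      (\<lambda>s. nreg s 0 = of_bool ?ok)"
    by (intro halts_Seq, elim halts_weaken) auto
  then have "halts (Seq (Instr (NConst 2 1)) (Seq ?loops (Instr (NCopy 0 2)))) s1 (1 + (?T + 1))
      (\<lambda>s. nreg s 0 = of_bool ?ok)"
    by (intro halts_Seq[OF halts_Instr] bounded) (simp_all add: s2_def)
  then have "halts decide_total (input_state n A) (1 + (1 + (?T + 1))) (\<lambda>s. nreg s 0 = of_bool ?ok)"
    unfolding decide_total_def s1_def
    by (rule halts_Seq[OF halts_Instr[OF _ bounded(1)], rotated]) simp
  then show ?thesis by (rule halts_weaken) (auto simp: decide_steps_def)
qed

lemma answers_decide_total:
  "answers_within ic tc decide_total (input_state n A)
     (\<forall>u<n. \<forall>v<n. dominated n A u v \<or> dominated n A v u) (decide_steps n * K)"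
  using halts_decide_total unfolding halts_def answers_within_def total_iff_compatible .

end

section \<open>Cost bounds\<close>

lemma answers_within_mono:
  "answers_within ic tc c s b T \<Longrightarrow> T \<le> T' \<Longrightarrow> answers_within ic tc c s b T'"
  unfolding answers_within_def by (meson order_trans)

lemma nat_size_le: "nat_size k \<le> k + 1"
  unfolding nat_size_def using floorlog_leI[of k 2 k] less_exp[of k] by simp

lemma real_size_pos: "1 \<le> real_size x"
  unfolding real_size_def by (simp split: prod.split)

lemma real_size_le_mat_size:
  assumes A: "A \<in> carrier_mat n n" and x: "x \<in> elements_mat A"
  shows "real_size x \<le> mat_size n A"
proof -
  obtain i j where ij: "i < n" "j < n" "x = A $$ (i, j)"
    using x A by (auto simp: elements_mat_def)
  have "real_size x \<le> (\<Sum>j<n. real_size (A $$ (i, j)))"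
    using ij by (auto intro: member_le_sum)
  also have "\<dots> \<le> mat_size n A"
    unfolding mat_size_def using ij by (intro member_le_sum[of i]) auto
  finally show ?thesis .
qed

lemma square_le_mat_size: "n * n \<le> mat_size n A"
proof -
  have "n * n = (\<Sum>i<n. \<Sum>j<n. 1)" by simp
  also have "\<dots> \<le> mat_size n A"
    unfolding mat_size_def by (intro sum_mono real_size_pos)
  finally show ?thesis .
qed

lemma bounded_cost_unit:
  "A \<in> carrier_mat n n \<Longrightarrow> bounded_cost unit_instr_cost unit_test_cost n A 1"
  by unfold_locales auto

text \<open>In a bounded state a natural number has size at most \<open>n * n + n + 2\<close>, and both \<open>n * n\<close> and \<open>n\<close>
  are at most the encoding length of the matrix, as each entry has size at least 1. The summand
  \<open>real_size 0\<close> is for real registers that have not been written and for memory outside the matrix.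
  The factor 2 is for the two operands.\<close>

lemma bounded_cost_log:
  assumes A: "A \<in> carrier_mat n n"
  defines "K \<equiv> 2 * (3 * mat_size n A + real_size 0 + 2)"
  shows "bounded_cost log_instr_cost log_test_cost n A K"
proof
  let ?k = "3 * mat_size n A + real_size 0 + 2"
  have "n \<le> n * n" by (cases n) auto
  then have n: "n * n \<le> mat_size n A" "n \<le> mat_size n A"
    using square_le_mat_size[of n A] by linarith+
  {
    fix s assume s: "bounded_state n A s"
    have nat: "nat_size (nreg s r) \<le> ?k" for r
    proof -
      have "nreg s r \<le> n * n + n + 1" using s by (simp add: bounded_state_def)
      then show ?thesis using nat_size_le[of "nreg s r"] n by linarith
    qed
    have elem: "real_size y \<le> ?k" if "y \<in> insert 0 (elements_mat A)" for y
      using that real_size_le_mat_size[OF A, of y] by auto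
    have rreg: "real_size (rreg s r) \<le> ?k" for r
      using s by (intro elem) (auto simp: bounded_state_def)
    have "rmem (input_state n A) a \<in> insert 0 (elements_mat A)" for a
    proof (cases "a < n * n")
      case True
      then have "n > 0" by (cases n) auto
      then have "a div n < n" "a mod n < n" using True by (auto simp: less_mult_imp_div_less)
      then have "A $$ (a div n, a mod n) \<in> elements_mat A" using A by (intro elements_matI) auto
      then show ?thesis using True by (simp add: input_state_def)
    qed (simp add: input_state_def)
    then have rmem: "real_size (rmem s a) \<le> ?k" for a
      using s by (intro elem) (simp add: bounded_state_def)
    show "log_test_cost b s \<le> K" for b
      unfolding K_def mult_2 by (cases b) (simp_all only: log_test_cost.simps add_mono nat rreg)
    show "log_instr_cost i s \<le> K" if "simple_instr i" for i
    proof (cases i)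
      case (NConst x k)
      then have "k \<le> 1" using that by simp
      then show ?thesis using NConst nat_size_le[of k] by (simp add: K_def)
    next
      case (NCopy x y)
      then show ?thesis using nat[of y] by (simp add: K_def)
    next
      case (NAdd x y z)
      then show ?thesis using nat[of y] nat[of z] by (simp add: K_def)
    next
      case (RLoad x y)
      then show ?thesis using nat[of y] rmem[of "nreg s y"] by (simp add: K_def)
    qed (use that in auto)
  }
qed (rule A)

text \<open>The step bounds as polynomials in \<open>n\<close>.\<close>

definition for_poly :: "nat poly \<Rightarrow> nat poly" where
  "for_poly T = [:3:] + [:0, 1:] * (T + [:3:])"

definition decide_poly :: "nat poly" where
  "decide_poly = [:3:] + for_poly (for_poly (for_poly (for_poly [:15:])))"

lemma poly_decide_poly: "poly decide_poly n = decide_steps n"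
  by (simp add: decide_poly_def decide_steps_def for_poly_def for_steps_def)

lemma decide_steps_mono: "n \<le> m \<Longrightarrow> decide_steps n \<le> decide_steps m"
  unfolding decide_steps_def for_steps_def by (intro add_mono mult_mono order_refl) auto

theorem proposition4p8:
  shows "poly_time_decidable sym_mats
    (\<lambda>n A. \<exists>P \<in> permutation_mats n. transpose_mat P * A * P \<in> monotone_mats n)"
  unfolding poly_time_decidable_def
proof (intro exI allI ballI conjI impI)
  fix n :: nat and A :: "real mat"
  assume sym: "A \<in> sym_mats n"
  then have A: "A \<in> carrier_mat n n" by (simp add: sym_mats_def)
  let ?Q = "\<exists>P \<in> permutation_mats n. transpose_mat P * A * P \<in> monotone_mats n"
  show "answers_within unit_instr_cost unit_test_cost decide_total (input_state n A) ?Q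
      (poly decide_poly n)"
    using bounded_cost.answers_decide_total[OF bounded_cost_unit[OF A]]
    by (simp add: monotone_reordering_iff_total[OF sym] poly_decide_poly)
  let ?m = "mat_size n A"
  have "n \<le> n * n" by (cases n) auto
  then have "n \<le> ?m" using square_le_mat_size[of n A] by linarith
  then have "decide_steps n * (2 * (3 * ?m + real_size 0 + 2))
      \<le> poly (decide_poly * [:2 * (real_size 0 + 2), 6:]) ?m"
    by (simp add: poly_decide_poly algebra_simps decide_steps_mono add_mono mult_mono)
  then show "answers_within log_instr_cost log_test_cost decide_total (input_state n A) ?Q
      (poly (decide_poly * [:2 * (real_size 0 + 2), 6:]) ?m)"
    unfolding monotone_reordering_iff_total[OF sym]
    using answers_within_mono bounded_cost.answers_decide_total[OF bounded_cost_log[OF A]] by blast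
qed

end
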